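(* For every real $\beta\ge1$, the kernel $\alpha$-point rounding algorithm with parameter $\beta$ described below is a $\beta e^{1/\beta}$-approximation for the min latency set cover problem; that is, for every instance the expected total cover time of its output is at most $\beta e^{1/\beta}$ times the optimum. In particular, $\beta=1$ gives an $e$-approximation.
   Context: Min latency set cover: input a finite hypergraph $H=(V,E)$ with $n=|V|$; a solution is a bijection $\sigma:V\to\{1,\dots,n\}$; the cover time of $e$ is $\max_{v\in e}\sigma(v)$ (i.e., the time by which all $|e|$ vertices of $e$ have appeared), and the objective is the sum of cover times. This is the special case $k_e=|e|$ of GMSSC. LP relaxation (with knapsack cover inequalities): variables $x_{v,t}\ge0$, $u_{e,t}\ge0$ for $v\in V$, $e\in E$, $t\in\{1,\dots,n\}$; minimize $\sum_{e,t}u_{e,t}$ subject to $\sum_v x_{v,t}\le1$ for all $t$, and for all $e,t$ and all $S\subseteq e$ with $|S|<k_e$: $(k_e-|S|)u_{e,t}+\sum_{v\in e\setminus S}\sum_{t'<t}x_{v,t'}\ge k_e-|S|$, where $k_e=|e|$. Algorithm with parameter $\beta$: (1) compute an optimal LP solution $x$; (2) for every vertex $v$ and integer $t\ge1$ set $z_{v,t}=\frac{\beta}{t}\sum_{t'\le t}x_{v,t'}$ (with $x_{v,t'}=0$ for $t'>n$); (3) for each $v$ independently draw $\alpha_v$ uniformly from $[0,1]$ and let $\tau(v)$ be the earliest integer $t\ge1$ with $\sum_{t'\le t}z_{v,t'}\ge\alpha_v$; (4) output the ordering of $V$ obtained by sorting vertices by $\tau(v)$, breaking ties uniformly at random. 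*)

theory Defs
  imports "HOL-Probability.Probability"
begin

text \<open>
  An instance is a finite hypergraph, i.e. a finite set \<open>V\<close> with \<open>E \<subseteq> Pow V\<close>. Orderings are
  extensional functions, so that there are exactly \<open>fact (card V)\<close> of them.
\<close>

definition orderings :: "'a set \<Rightarrow> ('a \<Rightarrow> nat) set" where
  "orderings V = {\<sigma> \<in> V \<rightarrow>\<^sub>E {1..card V}. bij_betw \<sigma> V {1..card V}}"

text \<open>An empty hyperedge is covered from the outset.\<close>

definition cover_time :: "('a \<Rightarrow> nat) \<Rightarrow> 'a set \<Rightarrow> nat" where
  "cover_time \<sigma> e = (if e = {} then 0 else Max (\<sigma> ` e))"

definition total_cover_time :: "'a set set \<Rightarrow> ('a \<Rightarrow> nat) \<Rightarrow> nat" where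
  "total_cover_time E \<sigma> = (\<Sum>e\<in>E. cover_time \<sigma> e)"

definition optimum :: "'a set \<Rightarrow> 'a set set \<Rightarrow> nat" where
  "optimum V E = Min (total_cover_time E ` orderings V)"

text \<open>
  Only the values of \<open>x\<close> and \<open>u\<close> at times \<open>1, \<dots>, card V\<close> matter. The last conjunct is the family
  of knapsack cover inequalities with covering requirement \<open>card e\<close>.
\<close>

definition lp_feasible ::
  "'a set \<Rightarrow> 'a set set \<Rightarrow> ('a \<Rightarrow> nat \<Rightarrow> real) \<Rightarrow> ('a set \<Rightarrow> nat \<Rightarrow> real) \<Rightarrow> bool" where
  "lp_feasible V E x u \<longleftrightarrow>
     (\<forall>v\<in>V. \<forall>t\<in>{1..card V}. 0 \<le> x v t) \<and>
     (\<forall>e\<in>E. \<forall>t\<in>{1..card V}. 0 \<le> u e t) \<and>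
     (\<forall>t\<in>{1..card V}. (\<Sum>v\<in>V. x v t) \<le> 1) \<and>
     (\<forall>e\<in>E. \<forall>t\<in>{1..card V}. \<forall>S. S \<subseteq> e \<and> card S < card e \<longrightarrow>
        (real (card e) - real (card S)) * u e t + (\<Sum>v\<in>e - S. \<Sum>t'\<in>{1..<t}. x v t')
          \<ge> real (card e) - real (card S))"

definition lp_value :: "'a set \<Rightarrow> 'a set set \<Rightarrow> ('a set \<Rightarrow> nat \<Rightarrow> real) \<Rightarrow> real" where
  "lp_value V E u = (\<Sum>e\<in>E. \<Sum>t\<in>{1..card V}. u e t)"

definition lp_optimal ::
  "'a set \<Rightarrow> 'a set set \<Rightarrow> ('a \<Rightarrow> nat \<Rightarrow> real) \<Rightarrow> ('a set \<Rightarrow> nat \<Rightarrow> real) \<Rightarrow> bool" where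
  "lp_optimal V E x u \<longleftrightarrow> lp_feasible V E x u \<and>
     (\<forall>x' u'. lp_feasible V E x' u' \<longrightarrow> lp_value V E u \<le> lp_value V E u')"

definition kernel :: "real \<Rightarrow> nat \<Rightarrow> ('a \<Rightarrow> nat \<Rightarrow> real) \<Rightarrow> 'a \<Rightarrow> nat \<Rightarrow> real" where
  "kernel \<beta> n x v t = \<beta> / real t * (\<Sum>t'\<in>{1..t}. if t' \<le> n then x v t' else 0)"

text \<open>
  A vertex \<open>v\<close> with \<open>x v t = 0\<close> for all \<open>t\<close> (possible even in an optimal LP solution) never
  reaches a positive threshold; its time is then \<open>\<infinity>\<close>, i.e. it is sorted to the end.
\<close>

definition alpha_point :: "real \<Rightarrow> nat \<Rightarrow> ('a \<Rightarrow> nat \<Rightarrow> real) \<Rightarrow> 'a \<Rightarrow> real \<Rightarrow> enat" where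
  "alpha_point \<beta> n x v a =
     (if \<exists>t\<ge>1. (\<Sum>t'\<in>{1..t}. kernel \<beta> n x v t') \<ge> a
      then enat (LEAST t. t \<ge> 1 \<and> (\<Sum>t'\<in>{1..t}. kernel \<beta> n x v t') \<ge> a)
      else \<infinity>)"

text \<open>
  Breaking ties uniformly at random amounts to a uniform choice among all orderings that are
  sorted with respect to \<open>\<tau>\<close>.
\<close>

definition sorted_orderings :: "'a set \<Rightarrow> ('a \<Rightarrow> enat) \<Rightarrow> ('a \<Rightarrow> nat) set" where
  "sorted_orderings V \<tau> = {\<sigma> \<in> orderings V. \<forall>v\<in>V. \<forall>w\<in>V. \<tau> v < \<tau> w \<longrightarrow> \<sigma> v < \<sigma> w}"

definition thresholds :: "'a set \<Rightarrow> ('a \<Rightarrow> real) measure" where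
  "thresholds V = Pi\<^sub>M V (\<lambda>_. uniform_measure lborel {0..1})"

definition kernel_rounding ::
  "real \<Rightarrow> 'a set \<Rightarrow> ('a \<Rightarrow> nat \<Rightarrow> real) \<Rightarrow> ('a \<Rightarrow> nat) measure" where
  "kernel_rounding \<beta> V x =
     thresholds V \<bind> (\<lambda>\<alpha>. measure_pmf (pmf_of_set
       (sorted_orderings V (\<lambda>v. alpha_point \<beta> (card V) x v (\<alpha> v)))))"

definition expected_cost :: "real \<Rightarrow> 'a set \<Rightarrow> 'a set set \<Rightarrow> ('a \<Rightarrow> nat \<Rightarrow> real) \<Rightarrow> real" where
  "expected_cost \<beta> V E x = (\<integral>\<sigma>. real (total_cover_time E \<sigma>) \<partial>kernel_rounding \<beta> V x)"

text \<open>
  The remaining facts show that the definitions above do not fall back on default values: the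
  uniform choice is over a finite nonempty set, the random output is a genuine probability
  distribution on orderings, and the cost is integrable.
\<close>

lemma finite_orderings: "finite V \<Longrightarrow> finite (orderings V)"
  unfolding orderings_def by (rule finite_subset[OF _ finite_PiE[of V "\<lambda>_. {1..card V}"]]) auto

lemma finite_sorted_orderings: "finite V \<Longrightarrow> finite (sorted_orderings V \<tau>)"
  unfolding sorted_orderings_def by (simp add: finite_orderings)

lemma sorted_orderings_nonempty:
  assumes "finite V"
  shows "sorted_orderings V \<tau> \<noteq> {}"
proof -
  obtain xs where xs: "set xs = V" "distinct xs" "sorted (map \<tau> xs)"
  proof -
    obtain ys where "set ys = V" "distinct ys"
      using finite_distinct_list[OF assms] by blast
    then show ?thesis
      using that[of "sort_key \<tau> ys"] by simp
  qed
  define n where "n = card V"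
  have len: "length xs = n"
    using xs distinct_card n_def by metis
  have bij: "bij_betw ((!) xs) {..<n} V"
    using bij_betw_nth[OF xs(2), of "{..<n}" V] xs(1) len by simp
  define f where "f = inv_into {..<n} ((!) xs)"
  have f: "bij_betw f V {..<n}"
    unfolding f_def using bij by (rule bij_betw_inv_into)
  have Suc: "bij_betw Suc {..<n} {1..n}"
    by (auto simp: bij_betw_def image_Suc_lessThan)
  define \<sigma> where "\<sigma> = restrict (\<lambda>v. Suc (f v)) V"
  have s: "bij_betw \<sigma> V {1..n}"
    using bij_betw_trans[OF f Suc] by (rule bij_betw_cong[THEN iffD1, rotated]) (simp add: \<sigma>_def)
  have "\<sigma> v < \<sigma> w" if "v \<in> V" "w \<in> V" "\<tau> v < \<tau> w" for v w
  proof (rule ccontr)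
    assume "\<not> \<sigma> v < \<sigma> w"
    then have le: "f w \<le> f v" using that by (simp add: \<sigma>_def)
    have "f v < n" using f that by (auto simp: bij_betw_def)
    then have "map \<tau> xs ! f w \<le> map \<tau> xs ! f v"
      using xs(3) le len by (intro sorted_nth_mono) auto
    moreover have "xs ! f v = v" "xs ! f w = w"
      using bij that unfolding f_def by (auto simp: bij_betw_inv_into_right)
    ultimately show False
      using le \<open>f v < n\<close> len that by simp
  qed
  then have "\<sigma> \<in> sorted_orderings V \<tau>"
    using s unfolding sorted_orderings_def orderings_def n_def[symmetric]
    by (auto simp: \<sigma>_def bij_betw_def extensional_def)
  then show ?thesis by blast
qed

lemma prob_space_unit_uniform: "prob_space (uniform_measure lborel {0..1::real})"
  by (rule prob_space_uniform_measure) auto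

lemma prob_space_thresholds: "prob_space (thresholds V)"
  unfolding thresholds_def by (intro prob_space_PiM prob_space_unit_uniform)

lemma measurable_alpha_point [measurable]:
  "alpha_point \<beta> n x v \<in> measurable borel (count_space UNIV)"
  unfolding alpha_point_def[abs_def] by measurable

lemma measurable_sorted_orderings:
  assumes "finite V"
  shows "(\<lambda>\<alpha>. sorted_orderings V (\<lambda>v. alpha_point \<beta> n x v (\<alpha> v)))
    \<in> measurable (thresholds V) (count_space (Pow (orderings V)))"
proof -
  have comp: "(\<lambda>\<alpha>. alpha_point \<beta> n x v (\<alpha> v)) \<in> measurable (thresholds V) (count_space UNIV)"
    if "v \<in> V" for v
  proof -
    have "(\<lambda>\<alpha>. \<alpha> v) \<in> measurable (thresholds V) (uniform_measure lborel {0..1::real})"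
      unfolding thresholds_def using that by (rule measurable_component_singleton)
    then have "(\<lambda>\<alpha>. \<alpha> v) \<in> measurable (thresholds V) borel"
      by (simp cong: measurable_cong_sets)
    then show ?thesis by measurable
  qed
  have less: "Measurable.pred (thresholds V)
      (\<lambda>\<alpha>. alpha_point \<beta> n x v (\<alpha> v) < alpha_point \<beta> n x w (\<alpha> w))"
    if "v \<in> V" "w \<in> V" for v w
    using measurable_compose[OF comp[OF that(1)], of "\<lambda>y. y" borel]
      measurable_compose[OF comp[OF that(2)], of "\<lambda>y. y" borel] by simp
  have "Measurable.pred (thresholds V)
      (\<lambda>\<alpha>. sorted_orderings V (\<lambda>v. alpha_point \<beta> n x v (\<alpha> v)) = A)"
    if "A \<subseteq> orderings V" for A
  proof -
    have eq: "sorted_orderings V \<tau> = A \<longleftrightarrow>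
      (\<forall>\<sigma>\<in>orderings V. \<sigma> \<in> A \<longleftrightarrow> (\<forall>v\<in>V. \<forall>w\<in>V. \<tau> v < \<tau> w \<longrightarrow> \<sigma> v < \<sigma> w))" for \<tau>
      using that unfolding sorted_orderings_def by blast
    show ?thesis
      unfolding eq using assms finite_orderings[OF assms] less
      by (intro pred_intros_finite pred_intros_logic) auto
  qed
  then have "(\<lambda>\<alpha>. sorted_orderings V (\<lambda>v. alpha_point \<beta> n x v (\<alpha> v))) -` {A} \<inter> space (thresholds V)
      \<in> sets (thresholds V)" if "A \<subseteq> orderings V" for A
    using that by (auto simp: pred_def vimage_def Int_def conj_commute)
  then show ?thesis
    using finite_orderings[OF assms]
    by (subst measurable_count_space_eq2) (auto simp: sorted_orderings_def)
qed

lemma measurable_rounding_step: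
  assumes "finite V"
  shows "(\<lambda>\<alpha>. measure_pmf (pmf_of_set (sorted_orderings V (\<lambda>v. alpha_point \<beta> n x v (\<alpha> v)))))
    \<in> measurable (thresholds V) (subprob_algebra (count_space UNIV))"
  by (rule measurable_compose[OF measurable_sorted_orderings[OF assms]])
     (auto simp: measurable_count_space_eq1 space_subprob_algebra
       intro: prob_space_imp_subprob_space measure_pmf.prob_space_axioms)

lemma sets_kernel_rounding:
  assumes "finite V"
  shows "sets (kernel_rounding \<beta> V x) = UNIV"
  unfolding kernel_rounding_def
  by (subst sets_bind[where N = "count_space UNIV"])
     (auto simp: prob_space.not_empty[OF prob_space_thresholds])

lemma prob_space_kernel_rounding:
  assumes "finite V"
  shows "prob_space (kernel_rounding \<beta> V x)"
  unfolding kernel_rounding_def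
  using measurable_rounding_step[OF assms]
  by (intro prob_space.prob_space_bind[OF prob_space_thresholds])
     (auto intro: measure_pmf.prob_space_axioms)

lemma AE_kernel_rounding_orderings:
  assumes "finite V"
  shows "AE \<sigma> in kernel_rounding \<beta> V x. \<sigma> \<in> orderings V"
proof -
  have "\<sigma> \<in> orderings V" if "\<sigma> \<in> set_pmf (pmf_of_set (sorted_orderings V \<tau>))" for \<sigma> \<tau>
    using that by (simp add: sorted_orderings_nonempty finite_sorted_orderings assms)
      (simp add: sorted_orderings_def)
  then show ?thesis
    unfolding kernel_rounding_def
    by (subst AE_bind[OF measurable_rounding_step[OF assms]]) (auto simp: AE_measure_pmf_iff)
qed

lemma integrable_total_cover_time:
  assumes "finite V"
  shows "integrable (kernel_rounding \<beta> V x) (\<lambda>\<sigma>. real (total_cover_time E \<sigma>))"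
proof -
  interpret prob_space "kernel_rounding \<beta> V x"
    by (rule prob_space_kernel_rounding[OF assms])
  define B where "B = Max (total_cover_time E ` orderings V)"
  have "AE \<sigma> in kernel_rounding \<beta> V x. norm (real (total_cover_time E \<sigma>)) \<le> real B"
    using AE_kernel_rounding_orderings[OF assms]
    by eventually_elim (simp add: B_def finite_orderings assms)
  then show ?thesis
    by (rule integrable_const_bound)
       (simp add: sets_kernel_rounding[OF assms] measurable_def)
qed

end

theory Submission
  imports Defs
begin

text \<open>
  Fix a nonempty hyperedge \<open>e\<close> and call a time \<open>t\<close> saturated if the kernel mass up to \<open>t\<close> is at least 1
  for every vertex of \<open>e\<close>; let \<open>N\<close> be the first saturated time, or \<open>card V\<close> if there is no earlier one.
  At a saturated time all of \<open>e\<close> has arrived whatever the thresholds are, and since each time step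
  carries kernel mass at most \<open>\<beta>\<close>, the expected number of vertices that arrived by \<open>N\<close> is at most
  \<open>\<beta> N\<close>. So the expected cover time of \<open>e\<close> is at most \<open>\<beta> N\<close>.

  On the other hand some \<open>v \<in> e\<close> is not saturated at \<open>N - 1\<close>. By the knapsack cover inequality for
  \<open>S = e - {v}\<close>, the LP mass of \<open>v\<close> up to \<open>s\<close> is at least \<open>1 - u e (s + 1)\<close>, hence
  \<open>\<Sum>s<N. (1 - u e (s + 1)) / s \<le> 1 / \<beta>\<close>. This harmonic budget forces
  \<open>N \<le> exp (1 / \<beta>) * (\<Sum>t. u e t)\<close>. Summing over \<open>e\<close> compares the cost with the LP value.
\<close>

section \<open>Exponential lower bound for prefix sums\<close>

text \<open>Inductive step of \<open>prefix_sum_ge_exp\<close>. After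
  \<open>1 + c / t \<le> exp (c / t)\<close>, clearing denominators leaves exactly
  \<open>c * (1 - c) \<ge> 0\<close>, hence the range required of \<open>c\<close>.\<close>

lemma succ_times_exp_minus_le:
  fixes c :: real and t :: nat
  assumes "t \<ge> 1" "0 \<le> c" "c \<le> 1"
  shows "(real t + 1) * exp (- (c / real t)) \<le> real t + 1 - c"
proof -
  have t: "real t \<ge> 1" using assms by simp
  have "1 + c / real t \<le> exp (c / real t)" by (rule exp_ge_add_one_self)
  then have "exp (- (c / real t)) \<le> 1 / (1 + c / real t)"
    using t assms by (simp add: exp_minus inverse_eq_divide frac_le add_pos_nonneg)
  also have "\<dots> = real t / (real t + c)"
    using t assms by (simp add: field_simps)
  also have "\<dots> \<le> (real t + 1 - c) / (real t + 1)"
  proof -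
    have "(real t + 1 - c) * (real t + c) - real t * (real t + 1) = c * (1 - c)"
      by (simp add: algebra_simps)
    moreover have "c * (1 - c) \<ge> 0" using assms by simp
    ultimately have "real t * (real t + 1) \<le> (real t + 1 - c) * (real t + c)" by linarith
    then show ?thesis using t assms by (simp add: frac_le_eq divide_simps)
  qed
  finally show ?thesis using t by (simp add: field_simps)
qed

text \<open>The exponent is the harmonic budget, with \<open>a\<close> in the role of
  \<open>u e\<close>. A value \<open>a (Suc s)\<close> below 1 shrinks the prefix sum but uses up
  budget at rate \<open>1 / s\<close>, so a bounded budget keeps the sum proportional to
  \<open>t\<close>.\<close>

lemma prefix_sum_ge_exp:
  fixes a :: "nat \<Rightarrow> real"
  assumes "t \<ge> 1" "a 1 \<ge> 1" "\<And>s. s \<in> {1..t} \<Longrightarrow> a s \<ge> 0"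
  shows "real t * exp (- (\<Sum>s\<in>{1..<t}. max 0 (1 - a (Suc s)) / real s)) \<le> (\<Sum>s\<in>{1..t}. a s)"
  using assms
proof (induction t rule: nat_induct_at_least)
  case base
  then show ?case by simp
next
  case (Suc t)
  define c where "c = max 0 (1 - a (Suc t))"
  define q where "q = exp (- (\<Sum>s\<in>{1..<t}. max 0 (1 - a (Suc s)) / real s))"
  have c: "0 \<le> c" "c \<le> 1" using Suc.prems(2)[of "Suc t"] by (auto simp: c_def)
  have q0: "0 \<le> q" by (simp add: q_def)
  have q1: "q \<le> 1" by (simp add: q_def sum_nonneg)
  have IH: "real t * q \<le> (\<Sum>s\<in>{1..t}. a s)"
    unfolding q_def using Suc by simp
  have sum: "(\<Sum>s\<in>{1..<Suc t}. max 0 (1 - a (Suc s)) / real s)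
      = (\<Sum>s\<in>{1..<t}. max 0 (1 - a (Suc s)) / real s) + c / real t"
    using Suc.hyps by (simp add: c_def)
  have "real (Suc t) * exp (- (\<Sum>s\<in>{1..<Suc t}. max 0 (1 - a (Suc s)) / real s))
      = q * ((real t + 1) * exp (- (c / real t)))"
    unfolding sum q_def minus_add_distrib exp_add by (simp add: add.commute)
  also have "\<dots> \<le> q * (real t + 1 - c)"
    using succ_times_exp_minus_le[OF Suc.hyps c] q0 by (rule mult_left_mono)
  also have "\<dots> = real t * q + q * (1 - c)" by (simp add: algebra_simps)
  \<comment> \<open>\<open>1 - c\<close> equals \<open>min 1 (a (Suc t))\<close>, so it is
    nonnegative here and at most \<open>a (Suc t)\<close> in the next step.\<close>
  also have "\<dots> \<le> real t * q + 1 * (1 - c)"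
    using q1 c by (intro add_left_mono mult_right_mono) auto
  also have "\<dots> \<le> (\<Sum>s\<in>{1..t}. a s) + a (Suc t)"
    using IH by (simp add: c_def)
  finally show ?case by simp
qed

section \<open>The LP value as a lower bound for the optimum\<close>

lemma orderings_nonempty: "finite V \<Longrightarrow> orderings V \<noteq> {}"
  using sorted_orderings_nonempty unfolding sorted_orderings_def by blast

lemma cover_time_le_card:
  assumes "finite V" "e \<subseteq> V" "\<sigma> \<in> orderings V"
  shows "cover_time \<sigma> e \<le> card V"
proof -
  have "finite e" using assms finite_subset by auto
  moreover have "\<sigma> v \<le> card V" if "v \<in> e" for v
    using assms that by (auto simp: orderings_def bij_betw_def)
  ultimately show ?thesis by (simp add: cover_time_def)
qed

text \<open>The integral solution of an ordering: \<open>x\<close> puts each vertex at its position,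
  and \<open>u e t\<close> is 1 as long as \<open>e\<close> is not covered strictly before
  \<open>t\<close>.\<close>

lemma lp_feasible_of_ordering:
  assumes V: "finite V" and E: "E \<subseteq> Pow V" and \<sigma>: "\<sigma> \<in> orderings V"
  shows "lp_feasible V E (\<lambda>v t. of_bool (\<sigma> v = t)) (\<lambda>e t. of_bool (t \<le> cover_time \<sigma> e))"
  unfolding lp_feasible_def
proof (intro conjI ballI allI impI)
  have inj: "inj_on \<sigma> V" and img: "\<sigma> ` V = {1..card V}"
    using \<sigma> by (auto simp: orderings_def bij_betw_def)
  show "(\<Sum>v\<in>V. of_bool (\<sigma> v = t) :: real) \<le> 1" if "t \<in> {1..card V}" for t
  proof -
    have "t \<in> \<sigma> ` V" using img that by simp
    then obtain v where v: "v \<in> V" "\<sigma> v = t" by blast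
    have "(\<Sum>w\<in>V. of_bool (\<sigma> w = t) :: real) = (\<Sum>w\<in>V. of_bool (w = v))"
      using v inj by (intro sum.cong) (auto simp: inj_on_def)
    also have "\<dots> = 1" using V v by (simp add: of_bool_def)
    finally show ?thesis by simp
  qed
  fix e t S
  assume e: "e \<in> E" and t: "t \<in> {1..card V}" and S: "S \<subseteq> e \<and> card S < card e"
  have fin: "finite e" using E e V by (meson PowD finite_subset subsetD)
  have ne: "e \<noteq> {}" using S by auto
  show "real (card e) - real (card S) \<le> (real (card e) - real (card S)) * of_bool (t \<le> cover_time \<sigma> e)
      + (\<Sum>v\<in>e - S. \<Sum>t'\<in>{1..<t}. of_bool (\<sigma> v = t'))"
  \<comment> \<open>If \<open>u e t\<close> is 1, the first term suffices; otherwise all of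
    \<open>e\<close> sits strictly before \<open>t\<close> and the double sum counts
    \<open>e - S\<close>.\<close>
  proof (cases "t \<le> cover_time \<sigma> e")
    case True
    then show ?thesis by (simp add: sum_nonneg)
  next
    case False
    have "(\<Sum>t'\<in>{1..<t}. of_bool (\<sigma> v = t') :: real) = 1" if "v \<in> e - S" for v
    proof -
      have "\<sigma> v \<le> cover_time \<sigma> e" using ne fin that by (simp add: cover_time_def)
      then have "\<sigma> v < t" using False by simp
      moreover have "\<sigma> v \<in> \<sigma> ` V" using that E e by blast
      then have "\<sigma> v \<ge> 1" using img by simp
      ultimately show ?thesis by (simp add: of_bool_def)
    qed
    then have "(\<Sum>v\<in>e - S. \<Sum>t'\<in>{1..<t}. of_bool (\<sigma> v = t') :: real) = real (card (e - S))"
      by simp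
    also have "\<dots> = real (card e) - real (card S)"
      using S fin card_Diff_subset[of S e] finite_subset[of S e] by (simp add: of_nat_diff)
    finally show ?thesis using False by simp
  qed
qed auto

text \<open>A cheapest ordering yields a feasible point in which the \<open>u e t\<close> add up
  over \<open>t\<close> to the cover time of \<open>e\<close>, so its value is the optimum.\<close>

lemma lp_value_le_optimum:
  assumes V: "finite V" and E: "E \<subseteq> Pow V" and opt: "lp_optimal V E x u"
  shows "lp_value V E u \<le> real (optimum V E)"
proof -
  have "optimum V E \<in> total_cover_time E ` orderings V"
    unfolding optimum_def using V finite_orderings orderings_nonempty by (intro Min_in) auto
  then obtain \<sigma> where \<sigma>: "\<sigma> \<in> orderings V" and o: "optimum V E = total_cover_time E \<sigma>" by blast
  have "lp_value V E u \<le> lp_value V E (\<lambda>e t. of_bool (t \<le> cover_time \<sigma> e))"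
    using opt lp_feasible_of_ordering[OF V E \<sigma>] unfolding lp_optimal_def by blast
  also have "\<dots> = real (\<Sum>e\<in>E. cover_time \<sigma> e)"
    unfolding lp_value_def of_nat_sum
  proof (rule sum.cong[OF refl])
    fix e assume "e \<in> E"
    then have "cover_time \<sigma> e \<le> card V" using cover_time_le_card[OF V _ \<sigma>] E by auto
    \<comment> \<open>The horizon \<open>card V\<close> of the LP cuts nothing off.\<close>
    then have "{1..card V} \<inter> {t. t \<le> cover_time \<sigma> e} = {1..cover_time \<sigma> e}" by auto
    then show "(\<Sum>t\<in>{1..card V}. of_bool (t \<le> cover_time \<sigma> e)) = real (cover_time \<sigma> e)"
      by (simp add: of_bool_def sum.If_cases)
  qed
  finally show ?thesis by (simp add: o total_cover_time_def)
qed

section \<open>Integration over thresholds and sorted orderings\<close>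

text \<open>The bound is assumed for every ordering sorted by arrival time, so it holds however ties
  are broken, and only the integral over the thresholds remains.\<close>

lemma nn_integral_kernel_rounding_le:
  assumes V: "finite V"
    and le: "AE \<alpha> in thresholds V.
      \<forall>\<sigma>\<in>sorted_orderings V (\<lambda>v. alpha_point \<beta> (card V) x v (\<alpha> v)). f \<sigma> \<le> g \<alpha>"
  shows "(\<integral>\<^sup>+\<sigma>. f \<sigma> \<partial>kernel_rounding \<beta> V x) \<le> (\<integral>\<^sup>+\<alpha>. g \<alpha> \<partial>thresholds V)"
proof -
  have "(\<integral>\<^sup>+\<sigma>. f \<sigma> \<partial>kernel_rounding \<beta> V x) = (\<integral>\<^sup>+\<alpha>. (\<integral>\<^sup>+\<sigma>. f \<sigma> \<partial>measure_pmf (pmf_of_set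
       (sorted_orderings V (\<lambda>v. alpha_point \<beta> (card V) x v (\<alpha> v))))) \<partial>thresholds V)"
    unfolding kernel_rounding_def
    by (rule nn_integral_bind[OF _ measurable_rounding_step[OF V]]) simp
  also have "\<dots> \<le> (\<integral>\<^sup>+\<alpha>. g \<alpha> \<partial>thresholds V)"
  proof (rule nn_integral_mono_AE, use le in eventually_elim)
    case (elim \<alpha>)
    let ?p = "pmf_of_set (sorted_orderings V (\<lambda>v. alpha_point \<beta> (card V) x v (\<alpha> v)))"
    have "(\<integral>\<^sup>+\<sigma>. f \<sigma> \<partial>measure_pmf ?p) \<le> (\<integral>\<^sup>+\<sigma>. g \<alpha> \<partial>measure_pmf ?p)"
      using elim by (intro nn_integral_mono_AE)
        (auto simp: AE_measure_pmf_iff sorted_orderings_nonempty finite_sorted_orderings V)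
    also have "\<dots> = g \<alpha>" by (simp add: measure_pmf.emeasure_space_1)
    finally show ?case .
  qed
  finally show ?thesis .
qed

lemma AE_thresholds_le_1:
  assumes "v \<in> V"
  shows "AE \<alpha> in thresholds V. \<alpha> v \<le> 1"
  unfolding thresholds_def
proof (rule AE_PiM_component[OF prob_space_unit_uniform assms])
  show "AE a in uniform_measure lborel {0..1::real}. a \<le> 1"
    by (rule AE_uniform_measureI) auto
qed

text \<open>The threshold \<open>\<alpha> v\<close> is uniform on the unit interval. This is an
  inequality because \<open>s\<close>, later a kernel mass, may exceed 1.\<close>

lemma prob_threshold_le:
  assumes "v \<in> V" "0 \<le> s"
  shows "(\<integral>\<^sup>+\<alpha>. indicator {..s} (\<alpha> v) \<partial>thresholds V) \<le> ennreal s"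
proof -
  let ?U = "uniform_measure lborel {0..1::real}"
  have "(\<integral>\<^sup>+\<alpha>. indicator {..s} (\<alpha> v) \<partial>thresholds V)
      = (\<integral>\<^sup>+a. indicator {..s} a \<partial>distr (thresholds V) ?U (\<lambda>\<alpha>. \<alpha> v))"
    using assms(1) unfolding thresholds_def by (subst nn_integral_distr) auto
  also have "\<dots> = (\<integral>\<^sup>+a. indicator {..s} a \<partial>?U)"
    unfolding thresholds_def by (subst distr_PiM_component[OF prob_space_unit_uniform assms(1)]) simp
  also have "\<dots> = emeasure lborel ({0..1} \<inter> {..s})"
    by (simp add: divide_ennreal_def)
  also have "\<dots> \<le> emeasure lborel {0..s}"
    by (rule emeasure_mono) auto
  also have "\<dots> = ennreal s" using assms by simp
  finally show ?thesis .
qed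

text \<open>In a sorted ordering, a vertex placed no later than the last vertex of \<open>e\<close>
  also arrives no later, hence by \<open>b\<close>. Such vertices fill an initial segment of
  positions whose length is the cover time.\<close>

lemma cover_time_le_card_prefix:
  assumes V: "finite V" and e: "e \<subseteq> V" and \<sigma>: "\<sigma> \<in> sorted_orderings V \<tau>"
    and le: "\<And>v. v \<in> e \<Longrightarrow> \<tau> v \<le> b"
  shows "cover_time \<sigma> e \<le> card {w \<in> V. \<tau> w \<le> b}"
proof (cases "e = {}")
  case False
  have fin: "finite e" using V e finite_subset by auto
  have inj: "inj_on \<sigma> V" and img: "\<sigma> ` V = {1..card V}"
    using \<sigma> by (auto simp: sorted_orderings_def orderings_def bij_betw_def)
  have "cover_time \<sigma> e \<in> \<sigma> ` e"
    using Max_in[of "\<sigma> ` e"] fin False by (simp add: cover_time_def)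
  then obtain v where v: "v \<in> e" "cover_time \<sigma> e = \<sigma> v" by blast
  have "\<sigma> v \<in> \<sigma> ` V" using v(1) e by blast
  then have vn: "\<sigma> v \<le> card V" using img by simp
  have "{1..\<sigma> v} \<subseteq> \<sigma> ` {w \<in> V. \<tau> w \<le> b}"
  proof
    fix t assume t: "t \<in> {1..\<sigma> v}"
    then have "t \<in> \<sigma> ` V" using img vn by auto
    then obtain w where w: "w \<in> V" "\<sigma> w = t" by blast
    have "\<tau> w \<le> \<tau> v"
    proof (rule ccontr)
      assume "\<not> \<tau> w \<le> \<tau> v"
      then have "\<sigma> v < \<sigma> w" using \<sigma> v w e by (auto simp: sorted_orderings_def)
      then show False using w t by simp
    qed
    then show "t \<in> \<sigma> ` {w \<in> V. \<tau> w \<le> b}" using w le[OF v(1)] by force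
  qed
  then have "card {1..\<sigma> v} \<le> card {w \<in> V. \<tau> w \<le> b}"
    using V by (intro surj_card_le) auto
  then show ?thesis using v by simp
qed (simp add: cover_time_def)

section \<open>Kernel mass, arrival times and the knapsack inequality\<close>

lemma kernel_nonneg:
  assumes "\<beta> \<ge> 0" "\<And>t. t \<in> {1..n} \<Longrightarrow> 0 \<le> x v t"
  shows "0 \<le> kernel \<beta> n x v t"
  unfolding kernel_def using assms by (intro mult_nonneg_nonneg sum_nonneg) auto

lemma alpha_point_le:
  assumes "N \<ge> 1" "a \<le> (\<Sum>t\<in>{1..N}. kernel \<beta> n x v t)"
  shows "alpha_point \<beta> n x v a \<le> enat N"
  using assms unfolding alpha_point_def by (auto intro!: Least_le)

text \<open>Converse of \<open>alpha_point_le\<close>. Nonnegativity makes the partial sums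
  monotone, which carries the bound from the least time to \<open>N\<close>; the finite bound
  \<open>enat N\<close> excludes an infinite arrival time.\<close>

lemma alpha_point_leD:
  assumes nonneg: "\<And>t. 0 \<le> kernel \<beta> n x v t" and le: "alpha_point \<beta> n x v a \<le> enat N"
  shows "a \<le> (\<Sum>t\<in>{1..N}. kernel \<beta> n x v t)"
proof -
  let ?P = "\<lambda>t. t \<ge> 1 \<and> (\<Sum>t'\<in>{1..t}. kernel \<beta> n x v t') \<ge> a"
  have ex: "\<exists>t. ?P t" and L: "(LEAST t. ?P t) \<le> N"
    using le unfolding alpha_point_def by (auto split: if_splits)
  have "a \<le> (\<Sum>t\<in>{1..(LEAST t. ?P t)}. kernel \<beta> n x v t)"
    using LeastI_ex[OF ex] by blast
  also have "\<dots> \<le> (\<Sum>t\<in>{1..N}. kernel \<beta> n x v t)"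
    using L nonneg by (intro sum_mono2) auto
  finally show ?thesis .
qed

text \<open>At each time the kernel is \<beta> times the average of the LP masses so far. Total LP
  mass per time is at most 1, so each time step contributes at most \<beta>.\<close>

lemma sum_kernel_le:
  assumes "\<beta> \<ge> 0" and "N \<le> n" and x: "\<And>t. t \<in> {1..n} \<Longrightarrow> (\<Sum>v\<in>V. x v t) \<le> 1"
  shows "(\<Sum>v\<in>V. \<Sum>t\<in>{1..N}. kernel \<beta> n x v t) \<le> \<beta> * real N"
proof -
  have "(\<Sum>v\<in>V. kernel \<beta> n x v t) \<le> \<beta>" if t: "t \<in> {1..N}" for t
  proof -
    \<comment> \<open>The cut-off at \<open>n\<close> inside the kernel is inactive, as
      \<open>t \<le> N \<le> n\<close>.\<close>
    have "(\<Sum>v\<in>V. kernel \<beta> n x v t) = \<beta> / real t * (\<Sum>v\<in>V. \<Sum>t'\<in>{1..t}. x v t')"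
      unfolding kernel_def sum_distrib_left[symmetric]
      using t assms(2) by (intro arg_cong[of _ _ "\<lambda>y. \<beta> / real t * y"] sum.cong) auto
    also have "(\<Sum>v\<in>V. \<Sum>t'\<in>{1..t}. x v t') = (\<Sum>t'\<in>{1..t}. \<Sum>v\<in>V. x v t')"
      by (rule sum.swap)
    also have "\<beta> / real t * \<dots> \<le> \<beta> / real t * (\<Sum>t'\<in>{1..t}. 1)"
      using t assms(1,2) by (intro mult_left_mono sum_mono x) auto
    also have "\<dots> = \<beta>" using t by simp
    finally show ?thesis .
  qed
  then have "(\<Sum>t\<in>{1..N}. \<Sum>v\<in>V. kernel \<beta> n x v t) \<le> (\<Sum>t\<in>{1..N}. \<beta>)"
    by (rule sum_mono)
  then show ?thesis by (subst sum.swap) (simp add: mult.commute)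
qed

text \<open>Taking \<open>S = e - {v}\<close> leaves a residual requirement of 1 and isolates the
  single vertex \<open>v\<close>.\<close>

lemma lp_feasible_singleton:
  assumes lp: "lp_feasible V E x u" and e: "e \<in> E" "finite e" and v: "v \<in> e" and t: "t \<in> {1..card V}"
  shows "1 - (\<Sum>t'\<in>{1..<t}. x v t') \<le> u e t"
proof -
  have card: "card e = Suc (card (e - {v}))" using card_Suc_Diff1[OF e(2) v] by simp
  have "(real (card e) - real (card (e - {v}))) * u e t
      + (\<Sum>w\<in>e - (e - {v}). \<Sum>t'\<in>{1..<t}. x w t') \<ge> real (card e) - real (card (e - {v}))"
  proof -
    have "\<forall>S. S \<subseteq> e \<and> card S < card e \<longrightarrow>
        (real (card e) - real (card S)) * u e t + (\<Sum>w\<in>e - S. \<Sum>t'\<in>{1..<t}. x w t')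
          \<ge> real (card e) - real (card S)"
      using lp e(1) t unfolding lp_feasible_def by blast
    then show ?thesis using card by (metis Diff_subset lessI)
  qed
  moreover have "e - (e - {v}) = {v}" using v by auto
  ultimately show ?thesis by (simp add: card)
qed

section \<open>Expected cover time of one hyperedge\<close>

lemma nn_integral_cover_time_le:
  assumes V: "finite V" and E: "E \<subseteq> Pow V" and lp: "lp_feasible V E x u"
    and \<beta>: "\<beta> \<ge> 1" and e: "e \<in> E" "e \<noteq> {}"
  shows "(\<integral>\<^sup>+\<sigma>. ennreal (real (cover_time \<sigma> e)) \<partial>kernel_rounding \<beta> V x)
    \<le> ennreal (\<beta> * exp (1 / \<beta>) * (\<Sum>t\<in>{1..card V}. u e t))"
proof -
  define n where "n = card V"
  define F where "F v t = (\<Sum>s\<in>{1..t}. kernel \<beta> n x v s)" for v t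
  define saturated where "saturated t \<longleftrightarrow> (\<forall>v\<in>e. F v t \<ge> 1)" for t
  \<comment> \<open>The alternative \<open>t = n\<close> makes the minimum exist and keeps
    \<open>N\<close> within the horizon on which the LP constraints are available.\<close>
  define N where "N = (LEAST t. t \<ge> 1 \<and> (t = n \<or> saturated t))"
  have eV: "e \<subseteq> V" using E e by auto
  then have fin: "finite e" using V finite_subset by blast
  have n: "n \<ge> 1" using eV e(2) V by (auto simp: n_def Suc_le_eq card_gt_0_iff)
  have N: "N \<ge> 1" "N = n \<or> saturated N" "N \<le> n"
    using LeastI[of "\<lambda>t. t \<ge> 1 \<and> (t = n \<or> saturated t)" n] n
    unfolding N_def by (auto intro!: Least_le)
  have x0: "0 \<le> x v t" if "v \<in> V" "t \<in> {1..n}" for v t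
    using lp that unfolding lp_feasible_def n_def by auto
  have u0: "0 \<le> u e t" if "t \<in> {1..n}" for t
    using lp that e unfolding lp_feasible_def n_def by auto
  have x1: "(\<Sum>v\<in>V. x v t) \<le> 1" if "t \<in> {1..n}" for t
    using lp that unfolding lp_feasible_def n_def by auto
  have k0: "0 \<le> kernel \<beta> n x v t" if "v \<in> V" for v t
    using \<beta> x0 that by (intro kernel_nonneg) auto
  have uge: "1 - (\<Sum>t'\<in>{1..<t}. x v t') \<le> u e t" if "v \<in> e" "t \<in> {1..n}" for v t
    using lp_feasible_singleton[OF lp e(1) fin] that unfolding n_def by blast

  \<comment> \<open>The weak inequality also covers \<open>N = 1\<close>, where \<open>F v 0\<close>
    is an empty sum; for larger \<open>N\<close>, minimality provides a vertex of mass below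
    1.\<close>
  have "\<exists>v\<in>e. F v (N - 1) \<le> 1"
  proof (cases "N = 1")
    case True
    then show ?thesis using e(2) by (auto simp: F_def)
  next
    case False
    then have "\<not> (N - 1 \<ge> 1 \<and> (N - 1 = n \<or> saturated (N - 1)))"
      using N(1) unfolding N_def by (intro not_less_Least) simp
    then show ?thesis using False N(1) unfolding saturated_def by force
  qed
  then obtain v where v: "v \<in> e" "F v (N - 1) \<le> 1" by blast
  have "\<beta> * (\<Sum>s\<in>{1..<N}. max 0 (1 - u e (Suc s)) / real s) \<le> F v (N - 1)"
  proof -
    have "\<beta> * (max 0 (1 - u e (Suc s)) / real s) \<le> kernel \<beta> n x v s" if s: "s \<in> {1..<N}" for s
    proof -
      \<comment> \<open>The knapsack inequality at time \<open>Suc s\<close> involves LP mass at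
        times up to \<open>s\<close>, exactly the mass that the kernel averages at \<open>s\<close>;
        hence the index shift.\<close>
      have "max 0 (1 - u e (Suc s)) \<le> (\<Sum>t'\<in>{1..s}. x v t')"
      proof (rule max.boundedI)
        show "0 \<le> (\<Sum>t'\<in>{1..s}. x v t')"
          using s N v eV by (intro sum_nonneg x0) auto
        show "1 - u e (Suc s) \<le> (\<Sum>t'\<in>{1..s}. x v t')"
          using uge[OF v(1), of "Suc s"] s N by (simp add: atLeastLessThanSuc_atLeastAtMost)
      qed
      also have "\<dots> = (\<Sum>t'\<in>{1..s}. if t' \<le> n then x v t' else 0)"
        using s N by (intro sum.cong) auto
      finally have "\<beta> / real s * max 0 (1 - u e (Suc s)) \<le> kernel \<beta> n x v s"
        unfolding kernel_def using \<beta> by (intro mult_left_mono) auto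
      then show ?thesis by simp
    qed
    then have "\<beta> * (\<Sum>s\<in>{1..<N}. max 0 (1 - u e (Suc s)) / real s) \<le> (\<Sum>s\<in>{1..<N}. kernel \<beta> n x v s)"
      unfolding sum_distrib_left by (rule sum_mono)
    moreover have "{1..<N} = {1..N - 1}" using N(1) by auto
    ultimately show ?thesis by (simp add: F_def)
  qed
  then have "(\<Sum>s\<in>{1..<N}. max 0 (1 - u e (Suc s)) / real s) \<le> 1 / \<beta>"
    using v(2) \<beta> by (simp add: field_simps)
  then have "real N * exp (- (1 / \<beta>))
      \<le> real N * exp (- (\<Sum>s\<in>{1..<N}. max 0 (1 - u e (Suc s)) / real s))"
    by (intro mult_left_mono) auto
  \<comment> \<open>No time precedes 1, so the knapsack inequality gives
    \<open>u e 1 \<ge> 1\<close>, the start of the induction in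
    \<open>prefix_sum_ge_exp\<close>.\<close>
  also have "\<dots> \<le> (\<Sum>s\<in>{1..N}. u e s)"
    using N uge[OF v(1), of 1] n u0 by (intro prefix_sum_ge_exp) auto
  also have "\<dots> \<le> (\<Sum>s\<in>{1..n}. u e s)"
    using N u0 by (intro sum_mono2) auto
  finally have "real N \<le> exp (1 / \<beta>) * (\<Sum>s\<in>{1..n}. u e s)"
    by (simp add: exp_minus field_simps)
  then have bound: "\<beta> * real N \<le> \<beta> * exp (1 / \<beta>) * (\<Sum>s\<in>{1..n}. u e s)"
    using \<beta> by (simp add: mult.assoc)

  have "(\<integral>\<^sup>+\<sigma>. ennreal (real (cover_time \<sigma> e)) \<partial>kernel_rounding \<beta> V x) \<le> ennreal (\<beta> * real N)"
  proof (cases "saturated N")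
    case True
    \<comment> \<open>\<open>?g\<close> counts the vertices whose threshold is met by time
      \<open>N\<close>; its expectation is bounded by linearity.\<close>
    let ?g = "\<lambda>\<alpha>. \<Sum>w\<in>V. indicator {..F w N} (\<alpha> w) :: ennreal"
    have "(\<integral>\<^sup>+\<sigma>. ennreal (real (cover_time \<sigma> e)) \<partial>kernel_rounding \<beta> V x)
        \<le> (\<integral>\<^sup>+\<alpha>. ?g \<alpha> \<partial>thresholds V)"
    proof (rule nn_integral_kernel_rounding_le[OF V])
      have "AE \<alpha> in thresholds V. \<forall>v\<in>e. \<alpha> v \<le> 1"
        using eV by (intro eventually_ball_finite fin ballI AE_thresholds_le_1) auto
      then show "AE \<alpha> in thresholds V.
          \<forall>\<sigma>\<in>sorted_orderings V (\<lambda>v. alpha_point \<beta> (card V) x v (\<alpha> v)).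
            ennreal (real (cover_time \<sigma> e)) \<le> ?g \<alpha>"
      proof (eventually_elim, intro ballI)
        fix \<alpha> \<sigma>
        assume \<alpha>: "\<forall>v\<in>e. \<alpha> v \<le> 1"
          and \<sigma>: "\<sigma> \<in> sorted_orderings V (\<lambda>v. alpha_point \<beta> (card V) x v (\<alpha> v))"
        have "alpha_point \<beta> (card V) x v (\<alpha> v) \<le> enat N" if "v \<in> e" for v
          using True \<alpha> that N(1) unfolding saturated_def F_def n_def
          by (intro alpha_point_le) force+
        then have "cover_time \<sigma> e \<le> card {w \<in> V. alpha_point \<beta> (card V) x w (\<alpha> w) \<le> enat N}"
          by (rule cover_time_le_card_prefix[OF V eV \<sigma>])
        also have "\<dots> \<le> card {w \<in> V. \<alpha> w \<le> F w N}"
          using V k0 unfolding F_def n_def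
          by (intro card_mono) (auto dest!: alpha_point_leD[rotated])
        finally have "ennreal (real (cover_time \<sigma> e)) \<le> of_nat (card {w \<in> V. \<alpha> w \<le> F w N})"
          by (simp add: ennreal_of_nat_eq_real_of_nat)
        also have "\<dots> = ?g \<alpha>"
          using V by (simp add: indicator_def sum.If_cases Int_def)
        finally show "ennreal (real (cover_time \<sigma> e)) \<le> ?g \<alpha>" .
      qed
    qed
    also have "\<dots> = (\<Sum>w\<in>V. \<integral>\<^sup>+\<alpha>. indicator {..F w N} (\<alpha> w) \<partial>thresholds V)"
      unfolding thresholds_def
      by (intro nn_integral_sum measurable_compose[OF measurable_component_singleton]) auto
    also have "\<dots> \<le> (\<Sum>w\<in>V. ennreal (F w N))"
      using k0 by (intro sum_mono prob_threshold_le) (auto simp: F_def sum_nonneg)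
    also have "\<dots> = ennreal (\<Sum>w\<in>V. F w N)"
      using k0 by (intro sum_ennreal) (auto simp: F_def sum_nonneg)
    also have "\<dots> \<le> ennreal (\<beta> * real N)"
      unfolding F_def using \<beta> N(3) x1 by (intro ennreal_leI sum_kernel_le) auto
    finally show ?thesis .
  next
    case False
    \<comment> \<open>Without saturation the cover time is only bounded by the number of vertices,
      and \<open>\<beta> \<ge> 1\<close> enters to pass from \<open>n\<close> to
      \<open>\<beta> * n\<close>.\<close>
    then have "N = n" using N by simp
    interpret prob_space "thresholds V" by (rule prob_space_thresholds)
    have "(\<integral>\<^sup>+\<sigma>. ennreal (real (cover_time \<sigma> e)) \<partial>kernel_rounding \<beta> V x)
        \<le> (\<integral>\<^sup>+\<alpha>. ennreal (\<beta> * real n) \<partial>thresholds V)"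
    proof (rule nn_integral_kernel_rounding_le[OF V], intro always_eventually allI ballI ennreal_leI)
      fix \<alpha> \<sigma>
      assume "\<sigma> \<in> sorted_orderings V (\<lambda>v. alpha_point \<beta> (card V) x v (\<alpha> v))"
      then have "cover_time \<sigma> e \<le> n"
        unfolding n_def using V eV by (intro cover_time_le_card) (auto simp: sorted_orderings_def)
      then have "real (cover_time \<sigma> e) \<le> 1 * real n" by simp
      also have "\<dots> \<le> \<beta> * real n" using \<beta> by (intro mult_right_mono) auto
      finally show "real (cover_time \<sigma> e) \<le> \<beta> * real n" .
    qed
    then show ?thesis using \<open>N = n\<close> by (simp add: emeasure_space_1)
  qed
  also have "\<dots> \<le> ennreal (\<beta> * exp (1 / \<beta>) * (\<Sum>s\<in>{1..n}. u e s))"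
    using bound by (rule ennreal_leI)
  finally show ?thesis by (simp add: n_def)
qed

section \<open>Summation over hyperedges\<close>

lemma expected_cost_le_lp_value:
  assumes V: "finite V" and E: "E \<subseteq> Pow V" and lp: "lp_feasible V E x u" and \<beta>: "\<beta> \<ge> 1"
  shows "expected_cost \<beta> V E x \<le> \<beta> * exp (1 / \<beta>) * lp_value V E u"
proof -
  let ?K = "kernel_rounding \<beta> V x"
  let ?b = "\<lambda>e. \<beta> * exp (1 / \<beta>) * (\<Sum>t\<in>{1..card V}. u e t)"
  have b0: "0 \<le> ?b e" if "e \<in> E" for e
    using lp that \<beta> unfolding lp_feasible_def by (intro mult_nonneg_nonneg sum_nonneg) auto
  have meas: "f \<in> borel_measurable ?K" for f :: "('a \<Rightarrow> nat) \<Rightarrow> ennreal"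
    by (simp add: sets_kernel_rounding[OF V] measurable_def)
  have "ennreal (expected_cost \<beta> V E x) = (\<integral>\<^sup>+\<sigma>. ennreal (real (total_cover_time E \<sigma>)) \<partial>?K)"
    unfolding expected_cost_def
    by (intro nn_integral_eq_integral[symmetric] integrable_total_cover_time V) auto
  also have "\<dots> = (\<integral>\<^sup>+\<sigma>. (\<Sum>e\<in>E. ennreal (real (cover_time \<sigma> e))) \<partial>?K)"
    by (simp add: total_cover_time_def)
  also have "\<dots> = (\<Sum>e\<in>E. \<integral>\<^sup>+\<sigma>. ennreal (real (cover_time \<sigma> e)) \<partial>?K)"
    by (rule nn_integral_sum) (rule meas)
  also have "\<dots> \<le> (\<Sum>e\<in>E. ennreal (?b e))"
  proof (rule sum_mono)
    fix e assume e: "e \<in> E"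
    show "(\<integral>\<^sup>+\<sigma>. ennreal (real (cover_time \<sigma> e)) \<partial>?K) \<le> ennreal (?b e)"
    \<comment> \<open>An empty hyperedge has cover time 0 by convention, so any bound in
      \<open>ennreal\<close> holds.\<close>
    proof (cases "e = {}")
      case True
      then show ?thesis by (simp add: cover_time_def)
    next
      case False
      then show ?thesis using nn_integral_cover_time_le[OF V E lp \<beta> e] by simp
    qed
  qed
  also have "\<dots> = ennreal (\<Sum>e\<in>E. ?b e)"
    by (rule sum_ennreal) (rule b0)
  finally have "expected_cost \<beta> V E x \<le> (\<Sum>e\<in>E. ?b e)"
    using b0 by (subst (asm) ennreal_le_iff) (auto intro: sum_nonneg)
  also have "\<dots> = \<beta> * exp (1 / \<beta>) * lp_value V E u"
    by (simp add: lp_value_def sum_distrib_left)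
  finally show ?thesis .
qed

theorem theorem7:
  fixes V :: "'a set" and E :: "'a set set"
    and x :: "'a \<Rightarrow> nat \<Rightarrow> real" and u :: "'a set \<Rightarrow> nat \<Rightarrow> real"
  assumes "finite V" and "E \<subseteq> Pow V" and "lp_optimal V E x u"
  shows "(\<forall>\<beta>\<ge>1. expected_cost \<beta> V E x \<le> \<beta> * exp (1 / \<beta>) * real (optimum V E)) \<and>
         expected_cost 1 V E x \<le> exp 1 * real (optimum V E)"
proof -
  have "expected_cost \<beta> V E x \<le> \<beta> * exp (1 / \<beta>) * real (optimum V E)" if \<beta>: "\<beta> \<ge> 1" for \<beta>
  proof -
    have "expected_cost \<beta> V E x \<le> \<beta> * exp (1 / \<beta>) * lp_value V E u"
      using assms \<beta> by (intro expected_cost_le_lp_value) (auto simp: lp_optimal_def)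
    also have "\<dots> \<le> \<beta> * exp (1 / \<beta>) * real (optimum V E)"
      using lp_value_le_optimum[OF assms] \<beta> by (intro mult_left_mono) auto
    finally show ?thesis .
  qed
  from this this[of 1] show ?thesis by simp
qed

end
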